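(* Let $\mathbb G=(\mathcal V,\mathcal E)$ be an undirected graph with node set $\mathcal V=\{1,\dots,N\}$ and Laplacian matrix $L_N$. Let $\mathcal S=\{s_1,\dots,s_l\}\subset\mathcal V$ with $1\le l<N$, and $\mathcal V\setminus\mathcal S=\{p_1,\dots,p_{N-l}\}$. For each $p_j\in\mathcal V\setminus\mathcal S$ let $w_{p_j}$ be the number of nodes in $\mathcal S$ that are connected by an edge with node $p_j$. Then $$\lambda_1(L(\mathcal S|\mathcal S))\le\frac{w_{p_1}+w_{p_2}+\dots+w_{p_{N-l}}}{N-l}$$ and $$\lambda_1(L(\mathcal S|\mathcal S))\ge\min\{w_{p_1},\dots,w_{p_{N-l}}\}.$$
   Context: Graphs have no self-loops or multiple edges. The Laplacian matrix $L_N=[l_{ij}]_{N\times N}$ of an undirected graph $\mathbb G$ is defined by: for $i\ne j$, $l_{ij}=-1$ if there is an edge between $i$ and $j$ and $l_{ij}=0$ otherwise; $l_{ii}=-\sum_{j\neq i}l_{ij}$. For $\mathcal S\subset\mathcal V$ with $|\mathcal S|=l$, $L(\mathcal S|\mathcal S)$ denotes the $(N-l)\times(N-l)$ principal submatrix of $L_N$ obtained by deleting the rows and columns corresponding to the nodes in $\mathcal S$. For a real symmetric matrix $M$, $\lambda_1(M)$ is its smallest eigenvalue. *)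

theory Defs
  imports
    "Graph_Theory.Pair_Digraph"
    "Jordan_Normal_Form.Spectral_Radius"
    "Jordan_Normal_Form.DL_Submatrix"
begin

text \<open>
  Simple undirected graphs are the symmetric loop-free digraphs without multiple arcs of
  \<^locale>\<open>pair_graph\<close>: an edge between \<open>u\<close> and \<open>v\<close> is the pair of arcs \<open>(u, v)\<close>, \<open>(v, u)\<close>.
  Matrix indices start at 0, so a graph on \<open>N\<close> nodes has the node set \<open>{..<N}\<close>.
\<close>

definition laplacian_offdiag :: "nat pair_pre_digraph \<Rightarrow> nat \<Rightarrow> nat \<Rightarrow> real" where
  "laplacian_offdiag G i j = (if (i, j) \<in> parcs G then - 1 else 0)"

definition laplacian :: "nat \<Rightarrow> nat pair_pre_digraph \<Rightarrow> real mat" where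
  "laplacian N G = mat N N (\<lambda>(i, j).
     if i = j then - (\<Sum>k \<in> {..<N} - {i}. laplacian_offdiag G i k)
     else laplacian_offdiag G i j)"

text \<open>\<open>A(S|S)\<close>: \<^const>\<open>submatrix\<close> takes the indices to keep, here the complement of \<open>S\<close>.\<close>

definition principal_delete :: "'a mat \<Rightarrow> nat set \<Rightarrow> 'a mat" where
  "principal_delete A S = submatrix A (- S) (- S)"

text \<open>
  Meant for symmetric matrices of positive dimension, whose set of real eigenvalues is
  finite and nonempty and comprises all eigenvalues.
\<close>

definition lambda_min :: "real mat \<Rightarrow> real" where
  "lambda_min A = Min (spectrum A)"

definition nbrs_in :: "nat pair_pre_digraph \<Rightarrow> nat set \<Rightarrow> nat \<Rightarrow> nat" where
  "nbrs_in G S p = card {s \<in> S. (p, s) \<in> parcs G}"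

end

theory Submission
  imports Defs
begin

text \<open>
  Put \<open>P = V - S\<close>, \<open>B = L(S|S)\<close>, and let \<open>f\<close> range over real functions on \<open>P\<close>. The diagonal entry
  of \<open>L\<close> at \<open>p\<close> is the degree of \<open>p\<close> in the whole graph, that is, \<open>w p\<close> plus the degree of \<open>p\<close> in
  the subgraph induced on \<open>P\<close>. So \<open>B\<close> is the Laplacian of that subgraph plus the diagonal
  matrix of the \<open>w p\<close>, and its quadratic form is (\<open>grounded_laplacian_form\<close>)
  \<open>f\<^sup>T B f = (\<Sum>p. w p * (f p)\<^sup>2) + (\<Sum>p q adjacent. (f p - f q)\<^sup>2) / 2\<close>, the last sum being over
  ordered pairs in \<open>P\<close>.

  Both bounds follow from the fact that the least eigenvalue of a symmetric matrix is the minimum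
  of its Rayleigh quotient. At \<open>f = 1\<close> the differences vanish and the quotient is the mean of the
  \<open>w p\<close>, whence the upper bound. For any \<open>f\<close>, dropping the squared differences leaves at least
  \<open>Min w\<close> times the squared norm of \<open>f\<close>, whence the lower bound.

  The existence of a real eigenvalue below all Rayleigh quotients
  (\<open>symmetric_eigenvalue_le_Rayleigh\<close>) is proved by algebra, without compactness of the unit
  sphere. Let \<open>k\<close> be the infimum of the quotients of \<open>A\<close>. Then \<open>A - k I\<close> is positive semidefinite.
  Were it invertible, its form would dominate a positive multiple of the squared norm
  (\<open>psd_invertible_coercive\<close>), and \<open>k\<close> could be raised. So it is singular, and \<open>k\<close> is an eigenvalue.
\<close>

section \<open>Quadratic forms of real symmetric matrices\<close>

lemma self_scalar_prod_pos:
  fixes x :: "real vec"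
  assumes "x \<in> carrier_vec n" "x \<noteq> 0\<^sub>v n"
  shows "0 < x \<bullet> x"
proof -
  obtain i where i: "i < n" "x $ i \<noteq> 0"
    using assms by (metis carrier_vecD eq_vecI index_zero_vec)
  have "0 < x $ i * x $ i" using i by (simp add: zero_less_mult_iff) linarith
  also have "\<dots> \<le> (\<Sum>j\<in>{0..<n}. x $ j * x $ j)"
    using i by (intro member_le_sum) auto
  finally show ?thesis using assms by (simp add: scalar_prod_def)
qed

lemma self_scalar_prod_nonneg: "0 \<le> x \<bullet> (x :: real vec)"
  by (simp add: scalar_prod_def sum_nonneg)

lemma scalar_prod_mult_mat_vec:
  fixes A :: "'a :: comm_semiring_0 mat"
  assumes "A \<in> carrier_mat n n" "x \<in> carrier_vec n" "y \<in> carrier_vec n"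
  shows "x \<bullet> (A *\<^sub>v y) = (\<Sum>i<n. \<Sum>j<n. A $$ (i, j) * x $ i * y $ j)"
  using assms
  by (auto simp: scalar_prod_def sum_distrib_left lessThan_atLeast0 ac_simps intro!: sum.cong)

lemma symmetric_form_commute:
  fixes A :: "'a :: comm_semiring_0 mat"
  assumes A: "A \<in> carrier_mat n n" and sym: "transpose_mat A = A"
    and x: "x \<in> carrier_vec n" and y: "y \<in> carrier_vec n"
  shows "x \<bullet> (A *\<^sub>v y) = y \<bullet> (A *\<^sub>v x)"
proof -
  have "A $$ (i, j) = A $$ (j, i)" if "i < n" "j < n" for i j
    using that A sym by (metis carrier_matD index_transpose_mat(1))
  then show ?thesis
    unfolding scalar_prod_mult_mat_vec[OF A x y] scalar_prod_mult_mat_vec[OF A y x]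
    by (subst sum.swap) (auto intro!: sum.cong simp: ac_simps)
qed

lemma symmetric_form_expand:
  fixes A :: "real mat"
  assumes A: "A \<in> carrier_mat n n" and sym: "transpose_mat A = A"
    and x: "x \<in> carrier_vec n" and y: "y \<in> carrier_vec n"
  shows "(s \<cdot>\<^sub>v x + t \<cdot>\<^sub>v y) \<bullet> (A *\<^sub>v (s \<cdot>\<^sub>v x + t \<cdot>\<^sub>v y))
    = s\<^sup>2 * (x \<bullet> (A *\<^sub>v x)) + 2 * s * t * (x \<bullet> (A *\<^sub>v y)) + t\<^sup>2 * (y \<bullet> (A *\<^sub>v y))"
proof -
  have c: "A *\<^sub>v x \<in> carrier_vec n" "A *\<^sub>v y \<in> carrier_vec n" using A x y by auto
  have "A *\<^sub>v (s \<cdot>\<^sub>v x + t \<cdot>\<^sub>v y) = s \<cdot>\<^sub>v (A *\<^sub>v x) + t \<cdot>\<^sub>v (A *\<^sub>v y)"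
    using A x y by (simp add: mult_add_distrib_mat_vec[of _ n n] mult_mat_vec[of _ n n])
  then show ?thesis
    using c x y symmetric_form_commute[OF A sym y x]
    by (simp add: add_scalar_prod_distrib[of _ n] scalar_prod_add_distrib[of _ n]
        algebra_simps power2_eq_square)
qed

text \<open>
  The form takes nonnegative values on all combinations of \<open>x\<close> and \<open>y\<close>. Semidefinite forms are
  allowed, so \<open>y\<close> may be a nonzero vector on which the form vanishes; that case is separate.
\<close>

lemma psd_Cauchy_Schwarz:
  fixes A :: "real mat"
  assumes A: "A \<in> carrier_mat n n" and sym: "transpose_mat A = A"
    and psd: "\<And>x. x \<in> carrier_vec n \<Longrightarrow> 0 \<le> x \<bullet> (A *\<^sub>v x)"
    and x: "x \<in> carrier_vec n" and y: "y \<in> carrier_vec n"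
  shows "(x \<bullet> (A *\<^sub>v y))\<^sup>2 \<le> (x \<bullet> (A *\<^sub>v x)) * (y \<bullet> (A *\<^sub>v y))"
proof -
  define a b c where "a = x \<bullet> (A *\<^sub>v x)" and "b = x \<bullet> (A *\<^sub>v y)" and "c = y \<bullet> (A *\<^sub>v y)"
  have q: "0 \<le> s\<^sup>2 * a + 2 * s * t * b + t\<^sup>2 * c" for s t
    unfolding a_def b_def c_def symmetric_form_expand[OF A sym x y, symmetric]
    using x y by (intro psd) auto
  have "b\<^sup>2 \<le> a * c"
  proof (cases "c = 0")
    case True
    have "b = 0"
    proof (rule ccontr)
      assume "b \<noteq> 0"
      \<comment> \<open>The form at \<open>x + t y\<close> is now the affine function \<open>a + 2 t b\<close>; this \<open>t\<close> makes it \<open>- 1\<close>.\<close>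
      then show False
        using q[of 1 "- (a + 1) / (2 * b)"] True by (simp add: field_simps)
    qed
    then show ?thesis using True by simp
  next
    case False
    then have "0 < c" using psd[OF y] c_def by simp
    \<comment> \<open>The minimum of the form over \<open>x + t y\<close> is at \<open>t = - b / c\<close>; scaling by \<open>c\<close> clears the fraction.\<close>
    moreover have "0 \<le> c * (a * c - b\<^sup>2)"
      using q[of c "- b"] by (simp add: algebra_simps power2_eq_square)
    ultimately show ?thesis by (simp add: zero_le_mult_iff)
  qed
  then show ?thesis by (simp add: a_def b_def c_def)
qed

lemma real_Cauchy_Schwarz_vec:
  fixes x y :: "real vec"
  assumes "x \<in> carrier_vec n" "y \<in> carrier_vec n"
  shows "(x \<bullet> y)\<^sup>2 \<le> (x \<bullet> x) * (y \<bullet> y)"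
  using psd_Cauchy_Schwarz[of "1\<^sub>m n" n x y] assms self_scalar_prod_nonneg by simp

lemma mult_mat_vec_bounded:
  fixes A :: "real mat"
  assumes A: "A \<in> carrier_mat n n"
  obtains C where "0 < C"
    and "\<And>x. x \<in> carrier_vec n \<Longrightarrow> (A *\<^sub>v x) \<bullet> (A *\<^sub>v x) \<le> C * (x \<bullet> x)"
proof
  \<comment> \<open>The squared Frobenius norm; the \<open>1\<close> added below only makes the bound positive for \<open>A = 0\<close>.\<close>
  let ?C = "(\<Sum>i<n. row A i \<bullet> row A i)"
  show "0 < ?C + 1"
    by (intro add_nonneg_pos sum_nonneg self_scalar_prod_nonneg) simp
  fix x :: "real vec" assume x: "x \<in> carrier_vec n"
  have "(A *\<^sub>v x) \<bullet> (A *\<^sub>v x) = (\<Sum>i<n. (row A i \<bullet> x)\<^sup>2)"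
    using A by (simp add: scalar_prod_def[of "A *\<^sub>v x"] power2_eq_square lessThan_atLeast0)
  also have "\<dots> \<le> (\<Sum>i<n. (row A i \<bullet> row A i) * (x \<bullet> x))"
    using A x by (intro sum_mono real_Cauchy_Schwarz_vec) auto
  also have "\<dots> \<le> (?C + 1) * (x \<bullet> x)"
    using self_scalar_prod_nonneg[of x] by (simp add: sum_distrib_right distrib_right)
  finally show "(A *\<^sub>v x) \<bullet> (A *\<^sub>v x) \<le> (?C + 1) * (x \<bullet> x)" .
qed

text \<open>
  With \<open>y = A x\<close>, Cauchy-Schwarz for the form of \<open>A\<close> gives
  \<open>(y \<bullet> y)\<^sup>2 = (y \<bullet> A x)\<^sup>2 \<le> (y \<bullet> A y) (x \<bullet> A x)\<close>. Boundedness of \<open>A\<close> turns this into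
  \<open>y \<bullet> y \<le> D (x \<bullet> A x)\<close>, and boundedness of the inverse of \<open>A\<close> gives \<open>x \<bullet> x \<le> K (y \<bullet> y)\<close>.
\<close>

lemma psd_invertible_coercive:
  fixes A :: "real mat"
  assumes A: "A \<in> carrier_mat n n" and sym: "transpose_mat A = A"
    and psd: "\<And>x. x \<in> carrier_vec n \<Longrightarrow> 0 \<le> x \<bullet> (A *\<^sub>v x)"
    and det: "det A \<noteq> 0"
  obtains e where "0 < e"
    and "\<And>x. x \<in> carrier_vec n \<Longrightarrow> e * (x \<bullet> x) \<le> x \<bullet> (A *\<^sub>v x)"
proof -
  obtain B where B: "B \<in> carrier_mat n n" and BA: "B * A = 1\<^sub>m n"
    using det_non_zero_imp_unit[OF A det] by (auto simp: Units_def ring_mat_def)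
  obtain C where C: "0 < C"
    "\<And>x. x \<in> carrier_vec n \<Longrightarrow> (A *\<^sub>v x) \<bullet> (A *\<^sub>v x) \<le> C * (x \<bullet> x)"
    using mult_mat_vec_bounded[OF A] by blast
  obtain K where K: "0 < K"
    "\<And>x. x \<in> carrier_vec n \<Longrightarrow> (B *\<^sub>v x) \<bullet> (B *\<^sub>v x) \<le> K * (x \<bullet> x)"
    using mult_mat_vec_bounded[OF B] by blast
  \<comment> \<open>From \<open>|A y|\<^sup>2 \<le> C |y|\<^sup>2\<close> one gets \<open>y \<bullet> A y \<le> sqrt C |y|\<^sup>2\<close>; \<open>C + 1\<close> exceeds \<open>sqrt C\<close> and avoids the root.\<close>
  let ?D = "C + 1"
  have "1 / (K * ?D) * (x \<bullet> x) \<le> x \<bullet> (A *\<^sub>v x)" if x: "x \<in> carrier_vec n" for x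
  proof -
    define y where "y = A *\<^sub>v x"
    have y: "y \<in> carrier_vec n" using A x by (simp add: y_def)
    have Ay: "A *\<^sub>v y \<in> carrier_vec n" using A y by simp
    have "B *\<^sub>v y = x"
      using A B BA x by (simp add: y_def flip: assoc_mult_mat_vec)
    then have xy: "x \<bullet> x \<le> K * (y \<bullet> y)" using K(2)[OF y] by simp
    have "(y \<bullet> (A *\<^sub>v y))\<^sup>2 \<le> (y \<bullet> y) * ((A *\<^sub>v y) \<bullet> (A *\<^sub>v y))"
      by (rule real_Cauchy_Schwarz_vec[OF y Ay])
    also have "\<dots> \<le> (y \<bullet> y) * (C * (y \<bullet> y))"
      by (intro mult_left_mono C y self_scalar_prod_nonneg)
    also have "\<dots> \<le> (?D * (y \<bullet> y))\<^sup>2"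
      using C(1) by (simp add: power2_eq_square algebra_simps)
    finally have yAy: "y \<bullet> (A *\<^sub>v y) \<le> ?D * (y \<bullet> y)"
      using C(1) self_scalar_prod_nonneg[of y] by (auto intro: power2_le_imp_le)
    have "(y \<bullet> y)\<^sup>2 = (y \<bullet> (A *\<^sub>v x))\<^sup>2" by (simp add: y_def)
    also have "\<dots> \<le> (y \<bullet> (A *\<^sub>v y)) * (x \<bullet> (A *\<^sub>v x))"
      by (rule psd_Cauchy_Schwarz[OF A sym psd y x])
    also have "\<dots> \<le> ?D * (y \<bullet> y) * (x \<bullet> (A *\<^sub>v x))"
      by (intro mult_right_mono yAy psd x)
    finally have *: "(y \<bullet> y) * (y \<bullet> y) \<le> (y \<bullet> y) * (?D * (x \<bullet> (A *\<^sub>v x)))"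
      by (simp add: power2_eq_square ac_simps)
    have "y \<bullet> y \<le> ?D * (x \<bullet> (A *\<^sub>v x))"
    proof (cases "y \<bullet> y = 0")
      case True
      then show ?thesis using C(1) psd[OF x] by simp
    next
      case False
      then have "0 < y \<bullet> y" using self_scalar_prod_nonneg[of y] by simp
      then show ?thesis using * by simp
    qed
    then have "K * (y \<bullet> y) \<le> K * (?D * (x \<bullet> (A *\<^sub>v x)))" using K(1) by simp
    with xy have "x \<bullet> x \<le> K * ?D * (x \<bullet> (A *\<^sub>v x))" by simp
    moreover have "0 < K * ?D" using K(1) C(1) by simp
    ultimately show ?thesis by (simp add: pos_divide_le_eq mult.commute)
  qed
  then show thesis using that[of "1 / (K * ?D)"] K(1) C(1) by simp
qed

section \<open>The least eigenvalue as the minimum of the Rayleigh quotient\<close>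

lemma char_matrix_form:
  fixes A :: "'a :: field mat"
  assumes A: "A \<in> carrier_mat n n" and x: "x \<in> carrier_vec n" and y: "y \<in> carrier_vec n"
  shows "x \<bullet> (char_matrix A k *\<^sub>v y) = x \<bullet> (A *\<^sub>v y) - k * (x \<bullet> y)"
proof -
  have "char_matrix A k *\<^sub>v y = A *\<^sub>v y + (- k) \<cdot>\<^sub>v y"
    unfolding char_matrix_def using A y
    by (intro eq_vecI) (auto simp: add_scalar_prod_distrib[of _ n])
  then show ?thesis using A x y by (simp add: scalar_prod_add_distrib[of _ n])
qed

lemma transpose_char_matrix:
  assumes "A \<in> carrier_mat n n"
  shows "transpose_mat (char_matrix A k) = char_matrix (transpose_mat A) k"
  using assms unfolding char_matrix_def by (intro eq_matI) auto

text \<open>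
  The eigenvalue is the infimum of the Rayleigh quotients. Cauchy-Schwarz and boundedness of \<open>A\<close> make
  the infimum finite; a determinant argument then replaces the search for a minimizing vector.
\<close>

lemma symmetric_eigenvalue_le_Rayleigh:
  fixes A :: "real mat"
  assumes A: "A \<in> carrier_mat n n" and sym: "transpose_mat A = A" and n: "0 < n"
  obtains k where "eigenvalue A k"
    and "\<And>x. x \<in> carrier_vec n \<Longrightarrow> k * (x \<bullet> x) \<le> x \<bullet> (A *\<^sub>v x)"
proof -
  define R where "R = {x \<bullet> (A *\<^sub>v x) / (x \<bullet> x) |x. x \<in> carrier_vec n \<and> x \<noteq> 0\<^sub>v n}"
  define k where "k = Inf R"
  obtain C where C: "0 < C"
    "\<And>x. x \<in> carrier_vec n \<Longrightarrow> (A *\<^sub>v x) \<bullet> (A *\<^sub>v x) \<le> C * (x \<bullet> x)"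
    using mult_mat_vec_bounded[OF A] by blast
  have "- (C + 1) \<le> x \<bullet> (A *\<^sub>v x) / (x \<bullet> x)" if x: "x \<in> carrier_vec n" "x \<noteq> 0\<^sub>v n" for x
  proof -
    have Ax: "A *\<^sub>v x \<in> carrier_vec n" using A x by simp
    have "(- (x \<bullet> (A *\<^sub>v x)))\<^sup>2 \<le> (x \<bullet> x) * ((A *\<^sub>v x) \<bullet> (A *\<^sub>v x))"
      using real_Cauchy_Schwarz_vec[OF x(1) Ax] by simp
    also have "\<dots> \<le> (x \<bullet> x) * (C * (x \<bullet> x))"
      by (intro mult_left_mono C x self_scalar_prod_nonneg)
    also have "\<dots> \<le> ((C + 1) * (x \<bullet> x))\<^sup>2"
      using C(1) by (simp add: power2_eq_square algebra_simps)
    finally have "- (x \<bullet> (A *\<^sub>v x)) \<le> (C + 1) * (x \<bullet> x)"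
      using C(1) self_scalar_prod_nonneg[of x] by (auto intro: power2_le_imp_le)
    then show ?thesis
      using self_scalar_prod_pos[OF x] by (simp add: field_simps)
  qed
  then have bdd: "bdd_below R" unfolding R_def by (auto intro!: bdd_belowI[of _ "- (C + 1)"])
  have "unit_vec n 0 \<noteq> (0\<^sub>v n :: real vec)" using n
    by (metis index_unit_vec(1) index_zero_vec(1) zero_neq_one)
  then have ne: "R \<noteq> {}" unfolding R_def by (auto intro!: exI[of _ "unit_vec n 0"])
  have le: "k * (x \<bullet> x) \<le> x \<bullet> (A *\<^sub>v x)" if x: "x \<in> carrier_vec n" for x
  proof (cases "x = 0\<^sub>v n")
    case True
    then show ?thesis using A by simp
  next
    case False
    then have "k \<le> x \<bullet> (A *\<^sub>v x) / (x \<bullet> x)"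
      unfolding k_def using x by (intro cInf_lower bdd) (auto simp: R_def)
    then show ?thesis using self_scalar_prod_pos[OF x False] by (simp add: field_simps)
  qed
  have "det (char_matrix A k) = 0"
  proof (rule ccontr)
    assume det: "det (char_matrix A k) \<noteq> 0"
    have M: "char_matrix A k \<in> carrier_mat n n"
      and Msym: "transpose_mat (char_matrix A k) = char_matrix A k"
      using A sym by (simp_all add: transpose_char_matrix[OF A])
    have "0 \<le> x \<bullet> (char_matrix A k *\<^sub>v x)" if "x \<in> carrier_vec n" for x
      using le[OF that] char_matrix_form[OF A that that] by simp
    then obtain e where e: "0 < e"
      "\<And>x. x \<in> carrier_vec n \<Longrightarrow> e * (x \<bullet> x) \<le> x \<bullet> (char_matrix A k *\<^sub>v x)"
      using psd_invertible_coercive[OF M Msym _ det] by blast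
    have "k + e \<le> x \<bullet> (A *\<^sub>v x) / (x \<bullet> x)" if x: "x \<in> carrier_vec n" "x \<noteq> 0\<^sub>v n" for x
      using e(2)[OF x(1)] self_scalar_prod_pos[OF x] char_matrix_form[OF A x(1) x(1)]
      by (simp add: field_simps)
    then have "k + e \<le> Inf R" by (intro cInf_greatest ne) (auto simp: R_def)
    then show False using e(1) by (simp add: k_def)
  qed
  then have "eigenvalue A k" using eigenvalue_det[OF A] by simp
  with le show thesis by (rule that[rotated])
qed

lemma lambda_min_le_Rayleigh:
  assumes A: "A \<in> carrier_mat n n" and sym: "transpose_mat A = A" and x: "x \<in> carrier_vec n"
  shows "lambda_min A * (x \<bullet> x) \<le> x \<bullet> (A *\<^sub>v x)"
proof (cases "n = 0")
  case True
  then show ?thesis using A x by (simp add: scalar_prod_def)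
next
  case False
  then obtain k where k: "eigenvalue A k"
    "\<And>x. x \<in> carrier_vec n \<Longrightarrow> k * (x \<bullet> x) \<le> x \<bullet> (A *\<^sub>v x)"
    using symmetric_eigenvalue_le_Rayleigh[OF A sym] by blast
  have "lambda_min A \<le> k"
    unfolding lambda_min_def using card_finite_spectrum[OF A] k(1)
    by (intro Min_le) (auto simp: spectrum_def)
  then have "lambda_min A * (x \<bullet> x) \<le> k * (x \<bullet> x)"
    by (intro mult_right_mono self_scalar_prod_nonneg)
  also have "\<dots> \<le> x \<bullet> (A *\<^sub>v x)" by (rule k(2)[OF x])
  finally show ?thesis .
qed

text \<open>An eigenvector attains the Rayleigh quotient \<^term>\<open>lambda_min A\<close>.\<close>

lemma lambda_min_greatest:
  assumes A: "A \<in> carrier_mat n n" and sym: "transpose_mat A = A" and n: "0 < n"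
    and c: "\<And>x. x \<in> carrier_vec n \<Longrightarrow> c * (x \<bullet> x) \<le> x \<bullet> (A *\<^sub>v x)"
  shows "c \<le> lambda_min A"
proof -
  have "spectrum A \<noteq> {}"
    using symmetric_eigenvalue_le_Rayleigh[OF A sym n] by (auto simp: spectrum_def)
  then have "lambda_min A \<in> spectrum A"
    unfolding lambda_min_def using card_finite_spectrum[OF A] by (intro Min_in) auto
  then obtain v where v: "v \<in> carrier_vec n" "v \<noteq> 0\<^sub>v n" "A *\<^sub>v v = lambda_min A \<cdot>\<^sub>v v"
    using A by (auto simp: spectrum_def eigenvalue_def eigenvector_def)
  then have "c * (v \<bullet> v) \<le> lambda_min A * (v \<bullet> v)" using c[OF v(1)] by simp
  then show ?thesis using self_scalar_prod_pos[OF v(1,2)] by simp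
qed

section \<open>The quadratic form of a grounded Laplacian\<close>

text \<open>
  The rows of a submatrix are numbered by \<^const>\<open>pick\<close>. This bijection and the next two lemmas
  replace vectors in these coordinates by functions on the kept index set itself, where the
  combinatorics of the graph is visible.
\<close>

lemma bij_betw_pick:
  "bij_betw (pick I) {..<card {i. i < n \<and> i \<in> I}} {i. i < n \<and> i \<in> I}"
proof -
  let ?P = "{i. i < n \<and> i \<in> I}"
  have sub: "?P \<subseteq> pick I ` {..<card ?P}"
  proof
    fix i assume i: "i \<in> ?P"
    then have "{a \<in> I. a < i} \<subset> ?P" by auto
    then have "card {a \<in> I. a < i} < card ?P" by (intro psubset_card_mono) auto
    then show "i \<in> pick I ` {..<card ?P}"
      using pick_card_in_set[of i I] i
      by (intro image_eqI[of _ _ "card {a \<in> I. a < i}"]) simp_all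
  qed
  have "card (pick I ` {..<card ?P}) \<le> card ?P"
    using card_image_le[of "{..<card ?P}" "pick I"] by simp
  with sub have eq: "pick I ` {..<card ?P} = ?P"
    by (intro card_seteq[symmetric]) auto
  then have "inj_on (pick I) {..<card ?P}" by (intro eq_card_imp_inj_on) auto
  with eq show ?thesis by (simp add: bij_betw_def)
qed

lemma vec_pick_surj:
  assumes "x \<in> carrier_vec (card {i. i < n \<and> i \<in> I})"
  obtains f where "x = vec (card {i. i < n \<and> i \<in> I}) (\<lambda>i. f (pick I i))"
proof
  let ?m = "card {i. i < n \<and> i \<in> I}"
  have inj: "inj_on (pick I) {..<?m}" using bij_betw_pick[of I n] by (simp add: bij_betw_def)
  have "the_inv_into {..<?m} (pick I) (pick I i) = i" if "i < ?m" for i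
    using that by (intro the_inv_into_f_f[OF inj]) simp
  then show "x = vec ?m (\<lambda>i. x $ the_inv_into {..<?m} (pick I) (pick I i))"
    using assms by (intro eq_vecI) simp_all
qed

lemma submatrix_form:
  fixes A :: "'a :: comm_semiring_0 mat" and f :: "nat \<Rightarrow> 'a" and I :: "nat set"
  assumes A: "A \<in> carrier_mat n n"
  defines "P \<equiv> {i. i < n \<and> i \<in> I}"
  defines "x \<equiv> vec (card P) (\<lambda>i. f (pick I i))"
  shows "x \<bullet> (submatrix A I I *\<^sub>v x) = (\<Sum>p\<in>P. \<Sum>q\<in>P. A $$ (p, q) * f p * f q)"
    and "x \<bullet> x = (\<Sum>p\<in>P. f p * f p)"
proof -
  note bij = bij_betw_pick[of I n, folded P_def]
  have S: "submatrix A I I \<in> carrier_mat (card P) (card P)"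
    using A by (simp add: submatrix_def P_def)
  have x: "x \<in> carrier_vec (card P)" by (simp add: x_def)
  have "x \<bullet> (submatrix A I I *\<^sub>v x)
    = (\<Sum>i<card P. \<Sum>j<card P. A $$ (pick I i, pick I j) * f (pick I i) * f (pick I j))"
    unfolding scalar_prod_mult_mat_vec[OF S x x]
    using A by (intro sum.cong refl) (simp add: x_def submatrix_def P_def)
  also have "\<dots> = (\<Sum>i<card P. \<Sum>q\<in>P. A $$ (pick I i, q) * f (pick I i) * f q)"
    by (intro sum.cong refl sum.reindex_bij_betw[OF bij])
  also have "\<dots> = (\<Sum>p\<in>P. \<Sum>q\<in>P. A $$ (p, q) * f p * f q)"
    by (rule sum.reindex_bij_betw[OF bij])
  finally show "x \<bullet> (submatrix A I I *\<^sub>v x) = \<dots>" .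
  show "x \<bullet> x = (\<Sum>p\<in>P. f p * f p)"
    unfolding sum.reindex_bij_betw[OF bij, symmetric]
    by (simp add: scalar_prod_def x_def lessThan_atLeast0)
qed

lemma transpose_submatrix_symmetric:
  assumes A: "A \<in> carrier_mat n n" and sym: "transpose_mat A = A"
  shows "transpose_mat (submatrix A I I) = submatrix A I I"
proof (rule eq_matI)
  have "A $$ (i, j) = A $$ (j, i)" if "i < n" "j < n" for i j
    using that A sym by (metis carrier_matD index_transpose_mat(1))
  then show "transpose_mat (submatrix A I I) $$ (i, j) = submatrix A I I $$ (i, j)"
    if "i < dim_row (submatrix A I I)" "j < dim_col (submatrix A I I)" for i j
    using that A by (auto simp: submatrix_def pick_le)
qed (use A in \<open>simp_all add: submatrix_def\<close>)

lemma (in pair_sym_digraph) parcs_sym: "(u, v) \<in> parcs G \<longleftrightarrow> (v, u) \<in> parcs G"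
  using pair_sym_arcs by (auto simp: symmetric_def sym_def)

lemma transpose_laplacian:
  assumes "pair_sym_digraph G"
  shows "transpose_mat (laplacian N G) = laplacian N G"
  using pair_sym_digraph.parcs_sym[OF assms]
  by (intro eq_matI) (auto simp: laplacian_def laplacian_offdiag_def)

text \<open>
  For \<open>p \<in> P\<close>, splitting the degree of \<open>p\<close> into neighbours in \<open>S\<close> and in \<open>P\<close> separates the \<open>w p\<close> from
  the Laplacian form of the induced subgraph. The latter is a sum of squares because each edge
  inside \<open>P\<close> contributes \<open>(f p)\<^sup>2 + (f q)\<^sup>2 - 2 f p f q\<close>; the factor \<open>1/2\<close> is there since the double
  sum meets every edge twice.
\<close>

lemma grounded_laplacian_form:
  fixes G :: "nat pair_pre_digraph" and f :: "nat \<Rightarrow> real"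
  assumes G: "pair_bidirected_digraph G" and S: "S \<subseteq> {..<N}"
  defines "P \<equiv> {..<N} - S"
  shows "(\<Sum>p\<in>P. \<Sum>q\<in>P. laplacian N G $$ (p, q) * f p * f q)
    = (\<Sum>p\<in>P. real (nbrs_in G S p) * (f p)\<^sup>2)
      + (\<Sum>p\<in>P. \<Sum>q\<in>P. of_bool ((p, q) \<in> parcs G) * (f p - f q)\<^sup>2) / 2"
proof -
  interpret pair_bidirected_digraph G by (rule G)
  define a :: "nat \<Rightarrow> nat \<Rightarrow> real" where "a p q = of_bool ((p, q) \<in> parcs G)" for p q
  have a_sym: "a p q = a q p" for p q unfolding a_def by (subst parcs_sym) (rule refl)
  have a_irrefl: "a p p = 0" for p using pair_no_loops by (force simp: a_def)
  have fin: "finite P" by (simp add: P_def)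
  have w: "(\<Sum>s\<in>S. a p s) = real (nbrs_in G S p)" for p
    using finite_subset[OF S] by (simp add: a_def nbrs_in_def of_bool_def sum.If_cases Int_def)
  have L: "laplacian N G $$ (p, q)
      = of_bool (p = q) * (real (nbrs_in G S p) + (\<Sum>r\<in>P. a p r)) - a p q"
    if "p \<in> P" "q \<in> P" for p q
  proof -
    have "- (\<Sum>k\<in>{..<N} - {p}. laplacian_offdiag G p k) = (\<Sum>k\<in>{..<N} - {p}. a p k)"
      unfolding sum_negf[symmetric] by (intro sum.cong refl) (simp add: laplacian_offdiag_def a_def)
    also have "\<dots> = (\<Sum>k<N. a p k)"
      using a_irrefl by (intro sum.mono_neutral_left) auto
    also have "\<dots> = (\<Sum>k\<in>P. a p k) + (\<Sum>k\<in>S. a p k)"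
      unfolding P_def by (intro sum.subset_diff S) simp
    finally have diag: "- (\<Sum>k\<in>{..<N} - {p}. laplacian_offdiag G p k)
        = real (nbrs_in G S p) + (\<Sum>k\<in>P. a p k)"
      by (simp add: w)
    have "p < N" "q < N" using that by (auto simp: P_def)
    then show ?thesis
      using diag a_irrefl[of p]
      by (cases "p = q") (simp_all add: laplacian_def, simp add: laplacian_offdiag_def a_def)
  qed
  have "(\<Sum>p\<in>P. \<Sum>q\<in>P. laplacian N G $$ (p, q) * f p * f q)
    = (\<Sum>p\<in>P. (real (nbrs_in G S p) + (\<Sum>r\<in>P. a p r)) * (f p)\<^sup>2 - (\<Sum>q\<in>P. a p q * f p * f q))"
  proof (intro sum.cong refl)
    fix p assume p: "p \<in> P"
    let ?d = "real (nbrs_in G S p) + (\<Sum>r\<in>P. a p r)"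
    have "(\<Sum>q\<in>P. laplacian N G $$ (p, q) * f p * f q)
      = (\<Sum>q\<in>P. (if p = q then ?d * f p * f q else 0) - a p q * f p * f q)"
      using p by (intro sum.cong refl) (simp add: L algebra_simps)
    also have "\<dots> = ?d * (f p)\<^sup>2 - (\<Sum>q\<in>P. a p q * f p * f q)"
      using p fin by (simp add: sum_subtractf power2_eq_square mult.assoc)
    finally show "(\<Sum>q\<in>P. laplacian N G $$ (p, q) * f p * f q)
      = ?d * (f p)\<^sup>2 - (\<Sum>q\<in>P. a p q * f p * f q)" .
  qed
  also have "\<dots> = (\<Sum>p\<in>P. real (nbrs_in G S p) * (f p)\<^sup>2)
      + ((\<Sum>p\<in>P. \<Sum>q\<in>P. a p q * (f p)\<^sup>2) - (\<Sum>p\<in>P. \<Sum>q\<in>P. a p q * f p * f q))"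
    by (simp add: distrib_right sum.distrib sum_subtractf sum_distrib_right)
  also have "(\<Sum>p\<in>P. \<Sum>q\<in>P. a p q * (f p)\<^sup>2) - (\<Sum>p\<in>P. \<Sum>q\<in>P. a p q * f p * f q)
      = (\<Sum>p\<in>P. \<Sum>q\<in>P. a p q * (f p - f q)\<^sup>2) / 2"
  proof -
    have "(\<Sum>p\<in>P. \<Sum>q\<in>P. a p q * (f q)\<^sup>2) = (\<Sum>p\<in>P. \<Sum>q\<in>P. a p q * (f p)\<^sup>2)"
      by (subst sum.swap) (simp add: a_sym)
    moreover have "(\<Sum>p\<in>P. \<Sum>q\<in>P. a p q * (f p - f q)\<^sup>2)
      = (\<Sum>p\<in>P. \<Sum>q\<in>P. a p q * (f p)\<^sup>2) + (\<Sum>p\<in>P. \<Sum>q\<in>P. a p q * (f q)\<^sup>2)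
        - 2 * (\<Sum>p\<in>P. \<Sum>q\<in>P. a p q * f p * f q)"
      unfolding sum_distrib_left sum.distrib[symmetric] sum_subtractf[symmetric]
      by (intro sum.cong refl) (simp add: power2_eq_square algebra_simps)
    ultimately show ?thesis by simp
  qed
  finally show ?thesis by (simp add: a_def)
qed

theorem theorem7:
  fixes G :: "nat pair_pre_digraph" and N l :: nat and S :: "nat set"
  assumes "pair_graph G" and "pverts G = {..<N}"
    and "S \<subseteq> {..<N}" and "card S = l" and "1 \<le> l" and "l < N"
  shows "lambda_min (principal_delete (laplacian N G) S)
           \<le> (\<Sum>p \<in> {..<N} - S. real (nbrs_in G S p)) / real (N - l)
       \<and> lambda_min (principal_delete (laplacian N G) S)
           \<ge> real (Min (nbrs_in G S ` ({..<N} - S)))"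
proof -
  interpret pair_graph G by (rule assms(1))
  define P where "P = {..<N} - S"
  have P: "{i. i < N \<and> i \<in> - S} = P" by (auto simp: P_def)
  have cardP: "card P = N - l" using assms(3,4)
    by (simp add: P_def card_Diff_subset finite_subset)
  then have pos: "0 < card P" using assms(6) by simp
  have L: "laplacian N G \<in> carrier_mat N N" by (simp add: laplacian_def)
  define B where "B = principal_delete (laplacian N G) S"
  have B: "B \<in> carrier_mat (card P) (card P)"
    using L by (simp add: B_def principal_delete_def submatrix_def flip: P)
  have sym: "transpose_mat B = B"
    unfolding B_def principal_delete_def
    by (intro transpose_submatrix_symmetric[OF L] transpose_laplacian pair_sym_digraph_axioms)
  have form: "vec (card P) (\<lambda>i. f (pick (- S) i)) \<bullet> (B *\<^sub>v vec (card P) (\<lambda>i. f (pick (- S) i)))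
      = (\<Sum>p\<in>P. real (nbrs_in G S p) * (f p)\<^sup>2)
        + (\<Sum>p\<in>P. \<Sum>q\<in>P. of_bool ((p, q) \<in> parcs G) * (f p - f q)\<^sup>2) / 2" for f :: "nat \<Rightarrow> real"
    using submatrix_form(1)[OF L, of "- S" f, unfolded P]
      grounded_laplacian_form[OF pair_bidirected_digraph_axioms assms(3), of f, folded P_def]
    by (simp add: B_def principal_delete_def)
  have norm: "vec (card P) (\<lambda>i. f (pick (- S) i)) \<bullet> vec (card P) (\<lambda>i. f (pick (- S) i))
      = (\<Sum>p\<in>P. (f p)\<^sup>2)" for f :: "nat \<Rightarrow> real"
    using submatrix_form(2)[OF L, of "- S" f, unfolded P] by (simp add: power2_eq_square)
  \<comment> \<open>The constant function \<open>1\<close> as test vector\<close>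
  have "lambda_min B * real (card P) \<le> (\<Sum>p\<in>P. real (nbrs_in G S p))"
    using lambda_min_le_Rayleigh[OF B sym, of "vec (card P) (\<lambda>_. 1)"]
      form[of "\<lambda>_. 1"] norm[of "\<lambda>_. 1"] by simp
  then have "lambda_min B \<le> (\<Sum>p\<in>P. real (nbrs_in G S p)) / real (N - l)"
    using pos by (simp add: field_simps flip: cardP)
  moreover have "real (Min (nbrs_in G S ` P)) \<le> lambda_min B"
  proof (rule lambda_min_greatest[OF B sym pos])
    fix x :: "real vec" assume "x \<in> carrier_vec (card P)"
    then obtain f where x: "x = vec (card P) (\<lambda>i. f (pick (- S) i))"
      using vec_pick_surj[of x N "- S"] unfolding P by blast
    have "real (Min (nbrs_in G S ` P)) * (x \<bullet> x)
        \<le> (\<Sum>p\<in>P. real (nbrs_in G S p) * (f p)\<^sup>2)"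
      unfolding x norm sum_distrib_left
      by (intro sum_mono mult_right_mono) (auto simp: P_def)
    also have "\<dots> \<le> x \<bullet> (B *\<^sub>v x)"
      unfolding x form by (simp add: sum_nonneg)
    finally show "real (Min (nbrs_in G S ` P)) * (x \<bullet> x) \<le> x \<bullet> (B *\<^sub>v x)" .
  qed
  ultimately show ?thesis by (simp add: B_def P_def)
qed

end
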